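(* Let $G$ be a finite abstract simplicial complex with connection Laplacian $L$ and let $\zeta(s)=\zeta_L(s)=\sum_k\lambda_k^{-s}$, where the $\lambda_k$ are the eigenvalues of $L$ counted with multiplicity. Then the Euler characteristic of $G$ satisfies $$\chi(G)=\zeta(0)-\frac{2i\,\zeta'(0)}{\pi}.$$
   Context: A finite abstract simplicial complex $G$ is a finite set of non-empty finite sets (simplices) closed under taking non-empty subsets. The dimension of $x\in G$ is $\dim(x)=|x|-1$ and $\chi(G)=\sum_{x\in G}(-1)^{\dim(x)}$. The connection Laplacian $L$ is the $|G|\times|G|$ matrix indexed by $G$ with $L(x,y)=1$ if $x\cap y\ne\emptyset$ and $0$ otherwise; it is symmetric and it is known that $|\det L|=1$, so all eigenvalues are real and non-zero. Powers are $\lambda^{-s}=e^{-s\log\lambda}$ with the branch $\log\lambda=\log|\lambda|+i\pi$ for $\lambda<0$ and the real logarithm for $\lambda>0$. *)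

theory Defs
  imports
    "HOL-Analysis.Analysis"
    "Jordan_Normal_Form.Spectral_Radius"
begin

text \<open>The empty complex is allowed; the empty set is not a simplex.\<close>

definition finite_abstract_simplicial_complex :: "'a set set \<Rightarrow> bool" where
  "finite_abstract_simplicial_complex G \<longleftrightarrow>
     finite G \<and> (\<forall>x\<in>G. finite x \<and> x \<noteq> {}) \<and> (\<forall>x\<in>G. \<forall>y. y \<subseteq> x \<and> y \<noteq> {} \<longrightarrow> y \<in> G)"

definition simplex_dim :: "'a set \<Rightarrow> nat" where
  "simplex_dim x = card x - 1"

definition euler_characteristic :: "'a set set \<Rightarrow> int" where
  "euler_characteristic G = (\<Sum>x\<in>G. (-1) ^ simplex_dim x)"

text \<open>
  Matrices are indexed by natural numbers, so a matrix indexed by \<open>G\<close> is given relative to a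
  repetition-free listing \<open>xs\<close> of \<open>G\<close>. The entries are complex so that the spectrum below
  contains all complex roots of the characteristic polynomial.
\<close>

definition connection_laplacian :: "'a set list \<Rightarrow> complex mat" where
  "connection_laplacian xs =
     Matrix.mat (length xs) (length xs) (\<lambda>(i, j). if xs ! i \<inter> xs ! j \<noteq> {} then 1 else 0)"

text \<open>
  Eigenvalues are weighted by their algebraic multiplicity, which for a real symmetric matrix is
  also the geometric one. For \<open>\<mu> \<noteq> 0\<close>, \<open>\<mu> powr (-s) = exp (-s * Ln \<mu>)\<close> with \<open>Im (Ln \<mu>)\<close> in
  \<open>(-pi, pi]\<close>, so \<open>Ln \<mu> = ln \<bar>\<mu>\<bar> + \<i> * pi\<close> for negative \<open>\<mu>\<close> and \<open>Ln \<mu> = ln \<mu>\<close> for positive \<open>\<mu>\<close>.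
\<close>

definition spectral_zeta :: "complex mat \<Rightarrow> complex \<Rightarrow> complex" where
  "spectral_zeta A s =
     (\<Sum>\<mu>\<in>spectrum A. of_nat (Polynomial.order \<mu> (char_poly A)) * \<mu> powr (- s))"

end

theory Submission
  imports Defs
begin

text \<open>
  Let \<open>\<lambda>\<^sub>k\<close> be the eigenvalues of the connection Laplacian \<open>L\<close> of a complex with \<open>n\<close> simplices. They
  are real and non-zero, so \<open>\<zeta>(0) = n\<close> and \<open>\<zeta>'(0) = - (\<Sum>k. Ln \<lambda>\<^sub>k)\<close>. With the chosen branch,
  \<open>Ln \<lambda>\<^sub>k\<close> is \<open>ln \<bar>\<lambda>\<^sub>k\<bar>\<close> plus \<open>\<i> * pi\<close> for each negative eigenvalue, and the real parts add up to
  \<open>ln \<bar>det L\<bar> = 0\<close>. Hence \<open>\<zeta>(0) - 2 * \<i> * \<zeta>'(0) / pi\<close> is \<open>n\<close> minus twice the number of negative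
  eigenvalues, which is the signature of \<open>L\<close> (lemma \<open>hermitian_zeta_signature\<close>).

  That the signature is the Euler characteristic follows from a congruence. Two simplices meet iff
  they have a common face, and the non-empty subsets of a non-empty set, weighted by \<open>(-1)^dim\<close>,
  add up to \<open>1\<close>. So \<open>L = P\<^sup>T D P\<close>, where \<open>P(z, x) = 1\<close> if \<open>z \<subseteq> x\<close> and \<open>0\<close> otherwise, and \<open>D\<close> is
  diagonal with entries \<open>(-1)^dim z\<close> (lemma \<open>connection_laplacian_factorization\<close>). The matrix \<open>P\<close> is
  unitriangular once the simplices are sorted by size, whence \<open>det P = 1\<close> and \<open>\<bar>det L\<bar> = 1\<close>. By
  Sylvester's law of inertia \<open>L\<close> and \<open>D\<close> have the same signature, and that of \<open>D\<close> is
  \<open>\<Sum>z\<in>G. (-1)^dim z\<close>.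

  Sylvester's law compares two diagonalisations of one Hermitian form. The one by eigenvalues, with
  their algebraic multiplicities, is the spectral theorem
  (theorem \<open>hermitian_unitarily_diagonalizable\<close>).
\<close>

section \<open>Adjoint matrices\<close>

lemma mat_adjoint_dim [simp]:
  "dim_row (mat_adjoint A) = dim_col A" "dim_col (mat_adjoint A) = dim_row A"
  by (simp_all add: mat_adjoint_def)

lemma mat_adjoint_carrier [simp]:
  "A \<in> carrier_mat m n \<Longrightarrow> mat_adjoint A \<in> carrier_mat n m"
  by (auto intro: carrier_matI)

lemma mat_adjoint_index [simp]:
  "i < dim_col A \<Longrightarrow> j < dim_row A \<Longrightarrow> mat_adjoint A $$ (i, j) = conjugate (A $$ (j, i))"
  by (simp add: mat_adjoint_def mat_of_rows_def)

lemma mat_adjoint_mult: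
  assumes "A \<in> carrier_mat m n" "B \<in> carrier_mat n k"
  shows "mat_adjoint (A * B) = mat_adjoint B * mat_adjoint A"
  using assms
  by (intro eq_matI)
     (auto simp: scalar_prod_def sum_conjugate conjugate_dist_mul mult.commute intro!: sum.cong)

lemma mat_adjoint_adjoint [simp]: "mat_adjoint (mat_adjoint A) = A"
  by (intro eq_matI) auto

lemma mat_adjoint_four_block:
  assumes "A \<in> carrier_mat a b" "B \<in> carrier_mat a c"
    and "C \<in> carrier_mat d b" "D \<in> carrier_mat d c"
  shows "mat_adjoint (four_block_mat A B C D) =
    four_block_mat (mat_adjoint A) (mat_adjoint C) (mat_adjoint B) (mat_adjoint D)"
  using assms by (intro eq_matI) auto

section \<open>The spectral theorem for Hermitian matrices\<close>

lemma conjugate_scalar_prod_self: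
  fixes v :: "complex Matrix.vec"
  shows "v \<bullet>c v = of_real (\<Sum>i<dim_vec v. (norm (v $ i))\<^sup>2)"
  by (simp add: scalar_prod_def complex_norm_square lessThan_atLeast0 del: of_real_power)

text \<open>
  Gram--Schmidt extends \<open>v\<close> to an orthogonal basis whose first member is \<open>v\<close> itself; dividing each
  member by its norm makes the matrix unitary, at the price of the scalar \<open>c\<close>.
\<close>

lemma unitary_with_first_column:
  fixes v :: "complex Matrix.vec"
  assumes v: "v \<in> carrier_vec n" and v0: "v \<noteq> 0\<^sub>v n"
  obtains U c where "U \<in> carrier_mat n n" "mat_adjoint U * U = 1\<^sub>m n" "col U 0 = c \<cdot>\<^sub>v v"
proof -
  interpret cof_vec_space n "TYPE(complex)" .
  note bc = basis_completion[OF v v0]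
  have n: "n \<noteq> 0"
    using v v0 by (auto intro!: eq_vecI)
  define ws where "ws = gram_schmidt n (basis_completion v)"
  obtain vs where bv: "basis_completion v = v # vs"
    using bc(6,7) n by (cases "basis_completion v") auto
  note gs = gram_schmidt_result[OF bc(2,4,5) ws_def]
  have ws: "corthogonal ws" "length ws = n" and ws_carrier: "\<And>i. i < n \<Longrightarrow> ws ! i \<in> carrier_vec n"
    using gs bc(6) by auto
  have hd_ws: "ws ! 0 = v"
    using gram_schmidt_hd[OF v, of vs] ws(2) n hd_conv_nth[of ws] unfolding ws_def bv by fastforce
  define r where "r i = sqrt (\<Sum>k<n. (norm (ws ! i $ k))\<^sup>2)" for i
  have r: "ws ! i \<bullet>c ws ! i = of_real (r i) * of_real (r i)" if "i < n" for i
    using ws_carrier[OF that]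
    by (simp add: conjugate_scalar_prod_self r_def sum_nonneg flip: of_real_mult)
  have r0: "r i \<noteq> 0" if "i < n" for i
    using r[OF that] corthogonalD[OF ws(1), of i i] ws(2) that by auto
  define U where "U = Matrix.mat n n (\<lambda>(i, j). ws ! j $ i / of_real (r j))"
  have U: "U \<in> carrier_mat n n" by (simp add: U_def)
  have "mat_adjoint U * U = 1\<^sub>m n"
  proof (intro eq_matI)
    fix i j assume "i < dim_row (1\<^sub>m n)" "j < dim_col (1\<^sub>m n)"
    then have ij: "i < n" "j < n" by auto
    have "(mat_adjoint U * U) $$ (i, j) = (ws ! j \<bullet>c ws ! i) / (of_real (r i) * of_real (r j))"
      using ij ws_carrier[of i] ws_carrier[of j]
      by (auto simp: U_def scalar_prod_def sum_divide_distrib intro!: sum.cong)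
    also have "\<dots> = (if i = j then 1 else 0)"
      using ij r[of i] r0[of i] corthogonalD[OF ws(1), of j i] ws(2) by auto
    finally show "(mat_adjoint U * U) $$ (i, j) = 1\<^sub>m n $$ (i, j)"
      using ij by simp
  qed (use U in auto)
  moreover have "col U 0 = (1 / of_real (r 0)) \<cdot>\<^sub>v v"
    using n ws(2) v hd_ws by (intro eq_vecI) (auto simp: U_def)
  ultimately show ?thesis
    using that U by blast
qed

lemma unitary_flip:
  assumes "U \<in> carrier_mat n n" "mat_adjoint U * U = 1\<^sub>m n"
  shows "(U :: complex mat) * mat_adjoint U = 1\<^sub>m n"
  using assms mat_mult_left_right_inverse[of "mat_adjoint U" n U] by auto

text \<open>
  Deflation: in an orthonormal basis starting with an eigenvector for \<open>e\<close>, the first column of the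
  matrix is \<open>(e, 0, \<dots>, 0)\<close>, and because the matrix stays Hermitian its first row is so too. What
  remains is a Hermitian block of size one less, whose characteristic polynomial has lost exactly
  the factor of \<open>e\<close>. The diagonal therefore lists the roots with their algebraic multiplicities,
  in the given order.
\<close>

theorem hermitian_unitarily_diagonalizable:
  fixes A :: "complex mat"
  assumes "A \<in> carrier_mat n n" "mat_adjoint A = A"
    and "char_poly A = (\<Prod>e\<leftarrow>es. [:- e, 1:])"
  shows "\<exists>U\<in>carrier_mat n n. mat_adjoint U * U = 1\<^sub>m n \<and>
    mat_adjoint U * A * U = mat_diag n ((!) es)"
  using assms
proof (induction es arbitrary: n A)
  case Nil
  then have "n = 0" using degree_monic_char_poly[of A n] by auto
  with Nil show ?case by (intro bexI[of _ "1\<^sub>m 0"]) (auto simp: mat_diag_def intro!: eq_matI)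
next
  case (Cons e es n A)
  note A = Cons.prems(1,2)
  have "degree (char_poly A) \<noteq> 0"
    unfolding Cons.prems(3) list.map prod_list.Cons
    by (subst degree_mult_eq) (auto simp: prod_list_zero_iff)
  with degree_monic_char_poly[OF A(1)] obtain m where n: "n = Suc m"
    by (cases n) auto
  have "eigenvalue A e"
    unfolding eigenvalue_root_char_poly[OF A(1)] Cons.prems(3) by simp
  then obtain v where v: "v \<in> carrier_vec n" "v \<noteq> 0\<^sub>v n" "A *\<^sub>v v = e \<cdot>\<^sub>v v"
    using A(1) by (auto simp: eigenvalue_def eigenvector_def)
  obtain W c where W: "W \<in> carrier_mat n n" "mat_adjoint W * W = 1\<^sub>m n" "col W 0 = c \<cdot>\<^sub>v v"
    using unitary_with_first_column[OF v(1,2)] .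
  have AW: "A * W \<in> carrier_mat n n" "mat_adjoint W * A \<in> carrier_mat n n"
    using A W by (auto intro!: carrier_matI)
  define B where "B = mat_adjoint W * A * W"
  have B: "B \<in> carrier_mat n n" using A W by (intro carrier_matI) (auto simp: B_def)
  have "mat_adjoint B = B"
    using A W AW
    by (simp add: B_def mat_adjoint_mult[of _ n n _ n] assoc_mult_mat[of _ n n _ n _ n])
  then have B_sym: "B $$ (j, i) = cnj (B $$ (i, j))" if "i < n" "j < n" for i j
    using B that mat_adjoint_index[of j B i] by simp
  have B_col: "B $$ (i, 0) = (if i = 0 then e else 0)" if "i < n" for i
  proof -
    have "col (A * W) 0 = A *\<^sub>v (c \<cdot>\<^sub>v v)"
      unfolding W(3)[symmetric] by (rule col_mult2[OF A(1) W(1)]) (simp add: n)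
    also have "\<dots> = c \<cdot>\<^sub>v (e \<cdot>\<^sub>v v)"
      using mult_mat_vec[OF A(1) v(1)] v(3) by simp
    also have "\<dots> = e \<cdot>\<^sub>v col W 0"
      by (simp add: W(3) smult_smult_assoc mult.commute)
    finally have "col (A * W) 0 = e \<cdot>\<^sub>v col W 0" .
    moreover have "B $$ (i, 0) = row (mat_adjoint W) i \<bullet> col (A * W) 0"
    proof -
      have "B = mat_adjoint W * (A * W)"
        using A W by (simp add: B_def assoc_mult_mat[of _ n n _ n _ n])
      then show ?thesis
        using W(1) that n index_mult_mat(1)[of i "mat_adjoint W" 0 "A * W"] by simp
    qed
    moreover have "row (mat_adjoint W) i \<bullet> col W 0 = (mat_adjoint W * W) $$ (i, 0)"
      using W(1) that n by simp
    moreover have "row (mat_adjoint W) i \<bullet> (e \<cdot>\<^sub>v col W 0) = e * (row (mat_adjoint W) i \<bullet> col W 0)"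
      by (rule scalar_prod_smult_distrib[of _ n]) (use W(1) that n in \<open>auto intro!: carrier_vecI\<close>)
    ultimately show ?thesis
      using that n by (simp add: W(2))
  qed
  have B_row: "B $$ (0, j) = (if j = 0 then e else 0)" if "j < n" for j
  proof (cases "j = 0")
    case False
    have "B $$ (0, j) = cnj (B $$ (j, 0))"
      using that n by (intro B_sym) auto
    with False show ?thesis
      by (simp add: B_col[OF that])
  qed (use B_col[of 0] n in simp)
  define C where "C = Matrix.mat m m (\<lambda>(i, j). B $$ (Suc i, Suc j))"
  have C: "C \<in> carrier_mat m m" by (simp add: C_def)
  have B_block: "B = four_block_mat (Matrix.mat 1 1 (\<lambda>_. e)) (0\<^sub>m 1 m) (0\<^sub>m m 1) C"
  proof (intro eq_matI, goal_cases)
    case (1 i j)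
    then have "i < n" "j < n" by (auto simp: n C_def)
    then show ?case
      using B_col[of i] B_row[of j]
      by (cases i; cases j) (auto simp: n C_def)
  qed (use B in \<open>auto simp: n C_def\<close>)
  have C_adj: "mat_adjoint C = C"
    by (intro eq_matI) (auto simp: C_def n intro: B_sym[symmetric])
  have WW: "W * mat_adjoint W = 1\<^sub>m n"
    by (rule unitary_flip[OF W(1,2)])
  have "similar_mat_wit B A (mat_adjoint W) W"
    by (rule similar_mat_witI[OF W(2) WW B_def B A(1)]) (use W in auto)
  then have "char_poly B = char_poly A"
    by (intro char_poly_similar) (auto simp: similar_mat_def)
  moreover have "char_poly B = [:- e, 1:] * char_poly C"
  proof -
    have "char_poly (Matrix.mat 1 1 (\<lambda>_. e)) = [:- e, 1:]"
      by (simp add: char_poly_defs det_def sign_def)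
    then show ?thesis
      unfolding B_block by (subst char_poly_four_block_zeros_col[OF _ _ C]) auto
  qed
  ultimately have "[:- e, 1:] * char_poly C = [:- e, 1:] * (\<Prod>e\<leftarrow>es. [:- e, 1:])"
    using Cons.prems(3) by simp
  then have "char_poly C = (\<Prod>e\<leftarrow>es. [:- e, 1:])"
    by (subst (asm) mult_cancel_left) simp
  from Cons.IH[OF C C_adj this] obtain V where
    V: "V \<in> carrier_mat m m" "mat_adjoint V * V = 1\<^sub>m m" "mat_adjoint V * C * V = mat_diag m ((!) es)"
    by auto
  define V' where "V' = four_block_mat (1\<^sub>m 1) (0\<^sub>m 1 m) (0\<^sub>m m 1) V"
  have V': "V' \<in> carrier_mat n n" using V by (auto simp: V'_def n)
  have adj1: "mat_adjoint (1\<^sub>m k :: complex mat) = 1\<^sub>m k"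
    and adj0: "mat_adjoint (0\<^sub>m k l :: complex mat) = 0\<^sub>m l k" for k l :: nat
    by (auto intro!: eq_matI)
  have V'_adj: "mat_adjoint V' = four_block_mat (1\<^sub>m 1) (0\<^sub>m 1 m) (0\<^sub>m m 1) (mat_adjoint V)"
    using V unfolding V'_def by (subst mat_adjoint_four_block) (auto simp: adj1 adj0)
  have *: "mat_adjoint (W * V') * X * (W * V') = mat_adjoint V' * (mat_adjoint W * X * W) * V'"
    if "X \<in> carrier_mat n n" for X
    using that W(1) V'
    by (simp add: mat_adjoint_mult[of _ n n _ n] assoc_mult_mat[of _ n n _ n _ n] mult_carrier_mat[of _ n n _ n])
  have "mat_adjoint (W * V') * (W * V') = mat_adjoint V' * V'"
    using *[of "1\<^sub>m n"] W V' by simp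
  also have "\<dots> = 1\<^sub>m n"
    unfolding V'_adj unfolding V'_def using V
    by (subst mult_four_block_mat[of _ 1 1 _ m _ m _ _ 1 _ m]) (auto simp: n)
  finally have 1: "mat_adjoint (W * V') * (W * V') = 1\<^sub>m n" .
  have "mat_adjoint (W * V') * A * (W * V') = mat_adjoint V' * B * V'"
    using *[OF A(1)] by (simp add: B_def)
  also have "\<dots> = four_block_mat (Matrix.mat 1 1 (\<lambda>_. e)) (0\<^sub>m 1 m) (0\<^sub>m m 1) (mat_diag m ((!) es))"
  proof -
    have "mat_adjoint V' * B =
        four_block_mat (Matrix.mat 1 1 (\<lambda>_. e)) (0\<^sub>m 1 m) (0\<^sub>m m 1) (mat_adjoint V * C)"
      unfolding V'_adj B_block using V(1) C
      by (subst mult_four_block_mat[of _ 1 1 _ m _ m _ _ 1 _ m]) auto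
    moreover have "mat_adjoint V * C \<in> carrier_mat m m"
      using V(1) C by (auto intro!: carrier_matI)
    ultimately show ?thesis
      unfolding V(3)[symmetric] using V(1)
      by (simp only: V'_def, subst mult_four_block_mat[of _ 1 1 _ m _ m _ _ 1 _ m]) auto
  qed
  also have "\<dots> = mat_diag n ((!) (e # es))"
    by (intro eq_matI) (auto simp: mat_diag_def n nth_Cons')
  finally show ?case
    using 1 W(1) V' by (intro bexI[of _ "W * V'"]) auto
qed

section \<open>Sylvester's law of inertia\<close>

text \<open>
  Fewer than \<open>n\<close> homogeneous linear equations in \<open>n\<close> unknowns have a non-trivial solution: padded
  with zero rows, the system has a singular square matrix.
\<close>

lemma common_orthogonal_vector:
  fixes R :: "complex Matrix.vec set"
  assumes "finite R" "R \<subseteq> carrier_vec n" "card R < n"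
  obtains v where "v \<in> carrier_vec n" "v \<noteq> 0\<^sub>v n" "\<And>r. r \<in> R \<Longrightarrow> r \<bullet> v = 0"
proof -
  obtain rs where rs: "set rs = R" "distinct rs"
    using finite_distinct_list[OF assms(1)] by auto
  then have len: "length rs < n"
    using assms(3) distinct_card[of rs] by simp
  \<comment> \<open>Row \<open>length rs\<close> is the zero row that makes the determinant vanish.\<close>
  define K where "K = mat\<^sub>r n n (\<lambda>i. if i = length rs then 0\<^sub>v n else (rs @ replicate n (0\<^sub>v n)) ! i)"
  have K: "K \<in> carrier_mat n n" by (simp add: K_def)
  have "det K = 0"
    unfolding K_def using len rs(1) assms(2)
    by (intro det_row_0) (auto simp: nth_append dest!: nth_mem)
  then obtain v where v: "v \<in> carrier_vec n" "v \<noteq> 0\<^sub>v n" "K *\<^sub>v v = 0\<^sub>v n"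
    using det_0_iff_vec_prod_zero_field[OF K] by auto
  show ?thesis
  proof (rule that[OF v(1,2)])
    fix r assume "r \<in> R"
    then obtain i where i: "i < length rs" "r = rs ! i"
      using rs(1) by (metis in_set_conv_nth)
    have "row K i = r"
      using i len rs(1) assms(2) nth_mem[OF i(1)]
      by (auto simp: K_def nth_append intro!: row_mat_of_row_fun)
    then show "r \<bullet> v = 0"
      using arg_cong[OF v(3), of "\<lambda>w. w $ i"] i len K by simp
  qed
qed

lemma mat_adjoint_inner:
  assumes "P \<in> carrier_mat m n" "x \<in> carrier_vec m" "v \<in> carrier_vec n"
  shows "(mat_adjoint P *\<^sub>v x) \<bullet>c v = x \<bullet>c (P *\<^sub>v v)"
proof -
  have "(mat_adjoint P *\<^sub>v x) \<bullet>c v = (\<Sum>i<n. \<Sum>k<m. conjugate (P $$ (k, i)) * x $ k * conjugate (v $ i))"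
    using assms by (auto simp: scalar_prod_def sum_distrib_right lessThan_atLeast0 intro!: sum.cong)
  also have "\<dots> = (\<Sum>k<m. \<Sum>i<n. conjugate (P $$ (k, i)) * x $ k * conjugate (v $ i))"
    by (rule sum.swap)
  also have "\<dots> = x \<bullet>c (P *\<^sub>v v)"
    using assms by (auto simp: scalar_prod_def sum_distrib_left lessThan_atLeast0 sum_conjugate
        conjugate_dist_mul mult_ac intro!: sum.cong)
  finally show ?thesis .
qed

lemma hermitian_form_of_diagonal:
  assumes P: "P \<in> carrier_mat n n" and v: "v \<in> carrier_vec n"
  shows "((mat_adjoint P * mat_diag n (\<lambda>i. complex_of_real (a i)) * P) *\<^sub>v v) \<bullet>c v =
    of_real (\<Sum>i<n. a i * (norm ((P *\<^sub>v v) $ i))\<^sup>2)"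
proof -
  let ?D = "mat_diag n (\<lambda>i. of_real (a i)) :: complex mat"
  define w where "w = P *\<^sub>v v"
  have w: "w \<in> carrier_vec n" using P v by (simp add: w_def)
  have D_w: "(?D *\<^sub>v w) $ i = of_real (a i) * w $ i" if "i < n" for i
    using w that by (simp add: mat_diag_def scalar_prod_def if_distrib[of "\<lambda>x. x * _"] cong: if_cong)
  have "mat_adjoint P * ?D \<in> carrier_mat n n"
    using P by (intro carrier_matI) (auto simp: mat_diag_def)
  then have "(mat_adjoint P * ?D * P) *\<^sub>v v = mat_adjoint P *\<^sub>v (?D *\<^sub>v w)"
    using assoc_mult_mat_vec[OF _ P v, of "mat_adjoint P * ?D" n] P w
    unfolding w_def by (subst assoc_mult_mat_vec[of "mat_adjoint P" n n ?D n, symmetric]) auto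
  also have "\<dots> \<bullet>c v = (?D *\<^sub>v w) \<bullet>c w"
    using mat_adjoint_inner[OF P mult_mat_vec_carrier[OF mat_diag_dim w] v] by (simp add: w_def)
  also have "\<dots> = of_real (\<Sum>i<n. a i * (norm (w $ i))\<^sup>2)"
    using w by (auto simp: D_w scalar_prod_def complex_norm_square lessThan_atLeast0
        simp del: of_real_power intro!: sum.cong)
  finally show ?thesis unfolding w_def .
qed

text \<open>
  If \<open>a\<close> had more positive entries than \<open>b\<close>, then fewer than \<open>n\<close> equations would express that
  \<open>P v\<close> vanishes where \<open>a \<le> 0\<close> and that \<open>Q v\<close> vanishes where \<open>b > 0\<close>. At a non-zero solution \<open>v\<close>
  the form is non-negative by the first diagonalisation and non-positive by the second, so it is
  \<open>0\<close>. Then \<open>P v\<close> vanishes where \<open>a > 0\<close> as well, which contradicts the invertibility of \<open>P\<close>.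
\<close>

lemma inertia_positive_le:
  fixes a b :: "nat \<Rightarrow> real"
  assumes P: "P \<in> carrier_mat n n" "det P \<noteq> 0" and Q: "Q \<in> carrier_mat n n"
    and eq: "mat_adjoint P * mat_diag n (\<lambda>i. of_real (a i)) * P =
      mat_adjoint Q * mat_diag n (\<lambda>i. complex_of_real (b i)) * Q"
  shows "card {i. i < n \<and> a i > 0} \<le> card {i. i < n \<and> b i > 0}"
proof (rule ccontr)
  assume less: "\<not> ?thesis"
  define I J where "I = {i. i < n \<and> \<not> a i > 0}" and "J = {i. i < n \<and> b i > 0}"
  define R where "R = row P ` I \<union> row Q ` J"
  have fin: "finite I" "finite J" by (simp_all add: I_def J_def)
  have "I \<union> {i. i < n \<and> a i > 0} = {..<n}" "I \<inter> {i. i < n \<and> a i > 0} = {}"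
    by (auto simp: I_def)
  then have "card I + card {i. i < n \<and> a i > 0} = n"
    using card_Un_disjoint[of I "{i. i < n \<and> a i > 0}"] fin by simp
  then have "card I + card J < n"
    using less by (simp add: J_def)
  moreover have "card R \<le> card I + card J"
    unfolding R_def using fin
    by (intro order_trans[OF card_Un_le] add_mono card_image_le)
  ultimately have "card R < n" by simp
  moreover have "finite R" "R \<subseteq> carrier_vec n"
    using fin P Q by (auto simp: R_def I_def J_def)
  ultimately obtain v where v: "v \<in> carrier_vec n" "v \<noteq> 0\<^sub>v n" "\<And>r. r \<in> R \<Longrightarrow> r \<bullet> v = 0"
    using common_orthogonal_vector[of R n] by blast
  have Pv: "(P *\<^sub>v v) $ i = 0" if "i < n" "\<not> a i > 0" for i
    using that v(3)[of "row P i"] P by (auto simp: R_def I_def)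
  have Qv: "(Q *\<^sub>v v) $ i = 0" if "i < n" "b i > 0" for i
    using that v(3)[of "row Q i"] Q by (auto simp: R_def J_def)
  define x y where "x i = (norm ((P *\<^sub>v v) $ i))\<^sup>2" and "y i = (norm ((Q *\<^sub>v v) $ i))\<^sup>2" for i
  have "complex_of_real (\<Sum>i<n. a i * x i) = complex_of_real (\<Sum>i<n. b i * y i)"
    unfolding x_def y_def hermitian_form_of_diagonal[OF P(1) v(1), symmetric]
      hermitian_form_of_diagonal[OF Q v(1), symmetric] eq ..
  then have "(\<Sum>i<n. a i * x i) = (\<Sum>i<n. b i * y i)"
    by (simp only: of_real_eq_iff)
  also have "\<dots> \<le> 0"
  proof (intro sum_nonpos)
    fix i assume "i \<in> {..<n}"
    then show "b i * y i \<le> 0"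
      using Qv[of i] by (cases "b i > 0") (auto simp: y_def mult_nonpos_nonneg)
  qed
  finally have "(\<Sum>i<n. a i * x i) \<le> 0" .
  moreover have nonneg: "a i * x i \<ge> 0" if "i < n" for i
    using Pv[OF that] by (cases "a i > 0") (auto simp: x_def)
  ultimately have "(\<Sum>i<n. a i * x i) = 0"
    by (intro antisym sum_nonneg) auto
  then have zero: "a i * x i = 0" if "i < n" for i
    using sum_nonneg_0[of "{..<n}" "\<lambda>i. a i * x i" i] nonneg that by auto
  have "P *\<^sub>v v = 0\<^sub>v n"
  proof (intro eq_vecI)
    fix i assume "i < dim_vec (0\<^sub>v n :: complex Matrix.vec)"
    then show "(P *\<^sub>v v) $ i = 0\<^sub>v n $ i"
      using Pv[of i] zero[of i] by (cases "a i > 0") (auto simp: x_def)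
  qed (use P in auto)
  then show False
    using det_0_iff_vec_prod_zero_field[OF P(1)] P(2) v(1,2) by blast
qed

text \<open>
  Negating the form exchanges positive and negative coefficients, so the bound on the number of
  positive coefficients, used in both directions for the form and its negative, fixes both counts.
\<close>

theorem sylvester_inertia:
  fixes a b :: "nat \<Rightarrow> real"
  assumes P: "P \<in> carrier_mat n n" "det P \<noteq> 0" and Q: "Q \<in> carrier_mat n n" "det Q \<noteq> 0"
    and eq: "mat_adjoint P * mat_diag n (\<lambda>i. of_real (a i)) * P =
      mat_adjoint Q * mat_diag n (\<lambda>i. complex_of_real (b i)) * Q"
  shows "(\<Sum>i<n. sgn (a i)) = (\<Sum>i<n. sgn (b i))"
proof -
  have signs: "(\<Sum>i<n. sgn (c i)) = real (card {i. i < n \<and> c i > 0}) - card {i. i < n \<and> - c i > 0}"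
    for c :: "nat \<Rightarrow> real"
  proof -
    have "(\<Sum>i<n. sgn (c i)) = (\<Sum>i<n. of_bool (c i > 0) - of_bool (- c i > 0))"
      by (intro sum.cong) (auto simp: sgn_if)
    then show ?thesis
      by (simp add: sum_subtractf of_bool_def sum.If_cases Collect_conj_eq lessThan_def)
  qed
  have neg: "mat_adjoint X * mat_diag n (\<lambda>i. complex_of_real (- c i)) * X =
      - (mat_adjoint X * mat_diag n (\<lambda>i. of_real (c i)) * X)"
    if "X \<in> carrier_mat n n" for X and c :: "nat \<Rightarrow> real"
  proof -
    have "mat_diag n (\<lambda>i. complex_of_real (- c i)) = - mat_diag n (\<lambda>i. of_real (c i))"
      by (intro eq_matI) (auto simp: mat_diag_def)
    then show ?thesis
      using that by (simp only: uminus_mult_right_mat uminus_mult_left_mat mat_adjoint_dim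
          index_mult_mat carrier_matD[OF mat_diag_dim] carrier_matD[OF that])
  qed
  have eq': "mat_adjoint P * mat_diag n (\<lambda>i. of_real (- a i)) * P =
      mat_adjoint Q * mat_diag n (\<lambda>i. complex_of_real (- b i)) * Q"
    unfolding neg[OF P(1)] neg[OF Q(1)] eq ..
  show ?thesis
    unfolding signs
    using inertia_positive_le[OF P Q(1) eq] inertia_positive_le[OF Q P(1) eq[symmetric]]
      inertia_positive_le[OF P Q(1) eq'] inertia_positive_le[OF Q P(1) eq'[symmetric]]
    by simp
qed

section \<open>The zeta function at the origin\<close>

lemma spectral_zeta_eq_sum_roots:
  assumes "A \<in> carrier_mat n n" "char_poly A = (\<Prod>e\<leftarrow>es. [:- e, 1:])"
  shows "spectral_zeta A s = (\<Sum>i<length es. (es ! i) powr (- s))"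
proof -
  have "spectrum A = set es"
    unfolding spectrum_root_char_poly[OF assms(1)] assms(2)
    by (auto simp: poly_prod_list prod_list_zero_iff)
  moreover have "order \<mu> (\<Prod>e\<leftarrow>es. [:- e, 1:]) = count_list es \<mu>" for \<mu> :: complex
  proof (induction es)
    case (Cons e es)
    have "order \<mu> ([:- e, 1:] * (\<Prod>e\<leftarrow>es. [:- e, 1:])) =
        order \<mu> [:- e, 1:] + order \<mu> (\<Prod>e\<leftarrow>es. [:- e, 1:])"
      by (intro order_mult) (auto simp: prod_list_zero_iff simp del: mult_pCons_left)
    with Cons.IH show ?case
      by (simp add: order_linear' del: mult_pCons_left)
  qed simp
  moreover have "(\<Sum>\<mu>\<in>X. of_nat (count_list es \<mu>) * f \<mu>) = (\<Sum>e\<leftarrow>es. f e)"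
    if "finite X" "set es \<subseteq> X" for f :: "complex \<Rightarrow> complex" and X
    using that(2)
  proof (induction es)
    case (Cons e es)
    have "(\<Sum>\<mu>\<in>X. of_nat (count_list (e # es) \<mu>) * f \<mu>) =
        (\<Sum>\<mu>\<in>X. (if \<mu> = e then f \<mu> else 0) + of_nat (count_list es \<mu>) * f \<mu>)"
      by (intro sum.cong) (auto simp: algebra_simps)
    with Cons that(1) show ?case
      by (simp add: sum.distrib)
  qed simp
  ultimately have "spectral_zeta A s = (\<Sum>e\<leftarrow>es. e powr (- s))"
    by (simp add: spectral_zeta_def assms(2))
  then show ?thesis
    by (simp add: sum_list_sum_nth lessThan_atLeast0)
qed

lemma deriv_sum_powr_at_0:
  fixes e :: "nat \<Rightarrow> complex"
  assumes "\<And>i. i < n \<Longrightarrow> e i \<noteq> 0"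
  shows "deriv (\<lambda>s. \<Sum>i<n. e i powr (- s)) 0 = - (\<Sum>i<n. Ln (e i))"
proof -
  have "((\<lambda>s. \<Sum>i<n. e i powr (- s)) has_field_derivative (\<Sum>i<n. - Ln (e i))) (at 0)"
    using assms by (intro DERIV_sum) (auto intro!: derivative_eq_intros simp: powr_def)
  then show ?thesis
    by (simp add: DERIV_imp_deriv sum_negf)
qed

lemma Ln_of_real_eq_ln_abs_sgn:
  assumes "x \<noteq> 0"
  shows "Ln (of_real x) = of_real (ln \<bar>x\<bar>) + \<i> * pi * (1 - of_real (sgn x)) / 2"
  using Ln_of_real'[OF assms] assms by (auto simp: sgn_if)

lemma det_mat_diag: "det (mat_diag n f) = (\<Prod>i<n. f i)"
proof -
  have "upper_triangular (mat_diag n f)"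
    by (auto simp: mat_diag_def)
  then have "det (mat_diag n f) = prod_list (diag_mat (mat_diag n f))"
    by (rule det_upper_triangular[OF _ mat_diag_dim])
  then show ?thesis
    by (simp add: diag_mat_def mat_diag_def prod.list_conv_set_nth lessThan_atLeast0)
qed

text \<open>
  The eigenvalues, and equally the \<open>a i\<close>, are the coefficients of diagonalisations of the same
  form. The determinant condition removes the real parts of the logarithms of the eigenvalues from
  \<open>\<zeta>'(0)\<close>, leaving \<open>\<i> * pi\<close> for each negative eigenvalue; for other invertible \<open>A\<close> the left-hand
  side has the extra term \<open>2 * \<i> * ln \<bar>det A\<bar> / pi\<close>.
\<close>

theorem hermitian_zeta_signature:
  fixes A P :: "complex mat" and a :: "nat \<Rightarrow> real"
  assumes A: "A \<in> carrier_mat n n" "mat_adjoint A = A" "norm (det A) = 1"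
    and P: "P \<in> carrier_mat n n" "det P \<noteq> 0"
    and A_P: "A = mat_adjoint P * mat_diag n (\<lambda>i. of_real (a i)) * P"
  shows "spectral_zeta A 0 - 2 * \<i> * deriv (spectral_zeta A) 0 / of_real pi =
    of_real (\<Sum>i<n. sgn (a i))"
proof -
  obtain es where es: "char_poly A = (\<Prod>e\<leftarrow>es. [:- e, 1:])" "length es = n"
    using char_poly_factorized[OF A(1)] by auto
  obtain U where U: "U \<in> carrier_mat n n" "mat_adjoint U * U = 1\<^sub>m n"
    and diag: "mat_adjoint U * A * U = mat_diag n ((!) es)"
    using hermitian_unitarily_diagonalizable[OF A(1,2) es(1)] by auto
  have UU: "U * mat_adjoint U = 1\<^sub>m n"
    by (rule unitary_flip[OF U])
  note carr = mult_carrier_mat[of _ n n _ n] assoc_mult_mat[of _ n n _ n _ n]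
  have det_U: "det (mat_adjoint U) * det U = 1"
    using det_mult[OF mat_adjoint_carrier[OF U(1)] U(1)] U(2) by simp
  \<comment> \<open>A diagonal Hermitian matrix is real, so no eigenvalue is lost by passing to real parts.\<close>
  define l where "l i = Re (es ! i)" for i
  have es_l: "es ! i = of_real (l i)" if "i < n" for i
  proof -
    have "mat_adjoint (mat_diag n ((!) es)) = mat_diag n ((!) es)"
      unfolding diag[symmetric] using A(1,2) U(1)
      by (simp add: mat_adjoint_mult[of _ n n _ n] carr)
    then have "mat_adjoint (mat_diag n ((!) es)) $$ (i, i) = mat_diag n ((!) es) $$ (i, i)"
      by simp
    then have "cnj (es ! i) = es ! i"
      using that by (simp add: mat_diag_def)
    then show ?thesis
      by (simp add: l_def complex_eq_iff)
  qed
  have diag_l: "mat_diag n ((!) es) = mat_diag n (\<lambda>i. of_real (l i))"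
    by (intro eq_matI) (auto simp: mat_diag_def es_l)
  have "U * (mat_adjoint U * A * U) * mat_adjoint U = (U * mat_adjoint U) * A * (U * mat_adjoint U)"
    using A(1) U(1) by (simp add: carr)
  then have A_U: "A = U * mat_diag n (\<lambda>i. of_real (l i)) * mat_adjoint U"
    using A(1) by (simp add: UU diag diag_l)
  have "det (mat_adjoint U * A * U) = det (mat_adjoint U) * det A * det U"
    using A(1) U(1) by (simp add: det_mult[of _ n] carr(1))
  then have det_l: "det A = (\<Prod>i<n. of_real (l i))"
    using det_U by (simp add: diag diag_l det_mat_diag mult_ac)
  have prod_l: "(\<Prod>i<n. \<bar>l i\<bar>) = 1"
    using A(3) unfolding det_l by (simp add: abs_prod flip: of_real_prod)
  then have l0: "l i \<noteq> 0" if "i < n" for i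
    using that by (metis (no_types, lifting) abs_eq_0 finite_lessThan lessThan_iff prod_zero zero_neq_one)
  have zeta: "spectral_zeta A = (\<lambda>s. \<Sum>i<n. (es ! i) powr (- s))"
    using spectral_zeta_eq_sum_roots[OF A(1) es(1)] es(2) by auto
  have "spectral_zeta A 0 = of_nat n"
    by (simp add: zeta es_l l0)
  moreover have "deriv (spectral_zeta A) 0 = - (\<Sum>i<n. Ln (of_real (l i)))"
    unfolding zeta by (subst deriv_sum_powr_at_0) (auto simp: es_l l0)
  moreover have "(\<Sum>i<n. Ln (of_real (l i))) = \<i> * pi * (of_nat n - of_real (\<Sum>i<n. sgn (l i))) / 2"
  proof -
    have "(\<Sum>i<n. Ln (of_real (l i))) =
        (\<Sum>i<n. of_real (ln \<bar>l i\<bar>) + \<i> * pi * (1 - of_real (sgn (l i))) / 2)"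
      by (intro sum.cong refl Ln_of_real_eq_ln_abs_sgn) (simp add: l0)
    also have "\<dots> = of_real (\<Sum>i<n. ln \<bar>l i\<bar>) + \<i> * pi * (of_nat n - of_real (\<Sum>i<n. sgn (l i))) / 2"
      by (simp add: sum.distrib sum_subtractf flip: sum_divide_distrib sum_distrib_left)
    also have "(\<Sum>i<n. ln \<bar>l i\<bar>) = ln (\<Prod>i<n. \<bar>l i\<bar>)"
      by (rule ln_prod[symmetric]) (auto simp: l0)
    finally show ?thesis
      by (simp add: prod_l)
  qed
  ultimately have "spectral_zeta A 0 - 2 * \<i> * deriv (spectral_zeta A) 0 / of_real pi =
      of_nat n - 2 * \<i> * (- (\<i> * pi * (of_nat n - of_real (\<Sum>i<n. sgn (l i))) / 2)) / of_real pi"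
    by simp
  also have "\<dots> = of_real (\<Sum>i<n. sgn (l i))"
    by (simp add: field_simps)
  also have "(\<Sum>i<n. sgn (l i)) = (\<Sum>i<n. sgn (a i))"
  proof (rule sylvester_inertia)
    show "det (mat_adjoint U) \<noteq> 0" using det_U by auto
    show "mat_adjoint (mat_adjoint U) * mat_diag n (\<lambda>i. of_real (l i)) * mat_adjoint U =
        mat_adjoint P * mat_diag n (\<lambda>i. complex_of_real (a i)) * P"
      using A_U A_P by simp
  qed (use U P in auto)
  finally show ?thesis .
qed

section \<open>The connection Laplacian as a congruence\<close>

text \<open>
  The Euler characteristic of a simplex is \<open>1\<close>. Expanding \<open>\<Prod>x\<in>w. (1 - 1)\<close> gives the alternating
  sum over all subsets; the empty set contributes the \<open>1\<close> that is split off.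
\<close>

lemma sum_alternating_nonempty_subsets:
  assumes "finite w" 
  shows "(\<Sum>z | z \<subseteq> w \<and> z \<noteq> {}. (-1) ^ (card z - 1)) = (of_bool (w \<noteq> {}) :: 'b :: comm_ring_1)"
proof -
  have "(\<Sum>z\<in>Pow w. (-1) ^ card z) = (of_bool (w = {}) :: 'b)"
  proof -
    have "(\<Sum>z\<in>Pow w. (-1) ^ card z) = (\<Prod>x\<in>w. 1 - 1 :: 'b)"
      by (subst prod_diff_conv_sum[OF assms]) simp
    then show ?thesis
      using assms by (simp add: power_0_left)
  qed
  moreover have "Pow w = insert {} {z. z \<subseteq> w \<and> z \<noteq> {}}" by auto
  moreover have "finite {z. z \<subseteq> w \<and> z \<noteq> {}}" using assms by simp
  ultimately have "(1 :: 'b) + (\<Sum>z | z \<subseteq> w \<and> z \<noteq> {}. (-1) ^ card z) = of_bool (w = {})"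
    by simp
  moreover have "(\<Sum>z | z \<subseteq> w \<and> z \<noteq> {}. (-1) ^ card z) =
      - (\<Sum>z | z \<subseteq> w \<and> z \<noteq> {}. (-1 :: 'b) ^ (card z - 1))"
    unfolding sum_negf[symmetric]
  proof (intro sum.cong refl)
    fix z assume "z \<in> {z. z \<subseteq> w \<and> z \<noteq> {}}"
    then have "card z \<noteq> 0" using assms by (auto dest: finite_subset)
    then show "(-1 :: 'b) ^ card z = - ((-1) ^ (card z - 1))"
      by (cases "card z") auto
  qed
  ultimately show ?thesis
    by (cases "w = {}") (simp_all add: add_eq_0_iff)
qed

text \<open>
  The matrix of the order relation of the face poset (its zeta function in the sense of incidence
  algebras).
\<close>

definition inclusion_matrix :: "'a set list \<Rightarrow> complex mat" where
  "inclusion_matrix xs =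
     Matrix.mat (length xs) (length xs) (\<lambda>(i, j). of_bool (xs ! i \<subseteq> xs ! j))"

text \<open>
  Expand over permutations. A permutation \<open>p\<close> contributes only if every \<open>x\<close> is contained in \<open>p(x)\<close>;
  as the cardinalities of all \<open>x\<close> and of all \<open>p(x)\<close> have the same sum, each inclusion is then an
  equality, so \<open>p\<close> is the identity. This is unitriangularity without sorting the list.
\<close>

lemma det_inclusion_matrix:
  assumes "distinct xs" "\<And>x. x \<in> set xs \<Longrightarrow> finite x"
  shows "det (inclusion_matrix xs) = 1"
proof -
  let ?n = "length xs"
  have only_id: "p = id" if p: "p permutes {0..<?n}" and sub: "\<forall>i<?n. xs ! i \<subseteq> xs ! p i" for p
  proof -
    have lt: "p i < ?n" if "i < ?n" for i
      using permutes_in_image[OF p, of i] that by simp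
    have le: "card (xs ! i) \<le> card (xs ! p i)" if "i < ?n" for i
      using sub that lt[OF that] assms(2) by (intro card_mono) auto
    have "(\<Sum>i\<in>{0..<?n}. card (xs ! i)) = (\<Sum>i\<in>{0..<?n}. card (xs ! p i))"
      using sum.permute[OF p, of "\<lambda>i. card (xs ! i)"] by (simp add: o_def)
    then have eq: "card (xs ! i) = card (xs ! p i)" if "i < ?n" for i
      using sum_mono_inv[of "\<lambda>i. card (xs ! i)" "{0..<?n}" "\<lambda>i. card (xs ! p i)" i] le that by auto
    have "xs ! i = xs ! p i" if "i < ?n" for i
      using card_subset_eq[of "xs ! p i" "xs ! i"] eq[OF that] sub that lt[OF that] assms(2) by auto
    then have "p i = i" if "i < ?n" for i
      using nth_eq_iff_index_eq[OF assms(1)] lt that by metis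
    then show "p = id"
      using permutes_not_in[OF p] by (metis atLeastLessThan_iff eq_id_iff)
  qed
  have "det (inclusion_matrix xs) = (\<Sum>p | p permutes {0..<?n}. of_int (sign p) * (\<Prod>i = 0..<?n. inclusion_matrix xs $$ (i, p i)))"
    by (rule det_def') (simp add: inclusion_matrix_def)
  also have "\<dots> = (\<Sum>p | p permutes {0..<?n}. of_bool (p = id))"
  proof (intro sum.cong refl)
    fix p assume "p \<in> {p. p permutes {0..<?n}}"
    then have p: "p permutes {0..<?n}" by simp
    have entry: "inclusion_matrix xs $$ (i, p i) = of_bool (xs ! i \<subseteq> xs ! p i)" if "i < ?n" for i
      using permutes_in_image[OF p, of i] that by (simp add: inclusion_matrix_def)
    show "of_int (sign p) * (\<Prod>i = 0..<?n. inclusion_matrix xs $$ (i, p i)) = of_bool (p = id)"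
    proof (cases "p = id")
      case False
      then obtain i where "i < ?n" "\<not> xs ! i \<subseteq> xs ! p i"
        using only_id[OF p] by blast
      then have "(\<Prod>i = 0..<?n. inclusion_matrix xs $$ (i, p i)) = 0"
        using entry by (intro prod_zero) auto
      then show ?thesis using False by simp
    qed (use entry in \<open>auto simp: sign_id\<close>)
  qed
  also have "\<dots> = 1"
    by (simp add: of_bool_def sum.delta permutes_id finite_permutations Collect_conj_eq)
  finally show ?thesis .
qed


text \<open>
  Entrywise, the product at \<open>(x, y)\<close> sums \<open>(-1)^dim z\<close> over the simplices \<open>z \<subseteq> x \<inter> y\<close>. Closure under
  faces makes these all the non-empty subsets of \<open>x \<inter> y\<close>.
\<close>

lemma connection_laplacian_factorization:
  assumes "finite_abstract_simplicial_complex (set xs)" "distinct xs"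
  shows "connection_laplacian xs = mat_adjoint (inclusion_matrix xs) *
    mat_diag (length xs) (\<lambda>i. of_real ((-1) ^ simplex_dim (xs ! i))) * inclusion_matrix xs"
    (is "_ = mat_adjoint ?P * ?D * ?P")
proof (rule sym, intro eq_matI)
  let ?n = "length xs"
  have fin: "finite x" if "x \<in> set xs" for x
    using assms(1) that by (auto simp: finite_abstract_simplicial_complex_def)
  have face: "y \<in> set xs" if "x \<in> set xs" "y \<subseteq> x" "y \<noteq> {}" for x y
    using assms(1) that unfolding finite_abstract_simplicial_complex_def by blast
  have ne: "{} \<notin> set xs"
    using assms(1) by (auto simp: finite_abstract_simplicial_complex_def)
  fix i j assume "i < dim_row (connection_laplacian xs)" "j < dim_col (connection_laplacian xs)"
  then have ij: "i < ?n" "j < ?n" by (auto simp: connection_laplacian_def)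
  let ?w = "xs ! i \<inter> xs ! j"
  have "(mat_adjoint ?P * ?D * ?P) $$ (i, j) =
      (\<Sum>k<?n. of_bool (xs ! k \<subseteq> ?w) * (-1) ^ simplex_dim (xs ! k))"
  proof -
    have PD: "mat_adjoint ?P * ?D = Matrix.mat ?n ?n (\<lambda>(i, k). mat_adjoint ?P $$ (i, k) * (-1) ^ simplex_dim (xs ! k))"
      by (subst mat_diag_mult_right[of _ ?n]) (auto simp: inclusion_matrix_def intro!: carrier_matI)
    have "(mat_adjoint ?P * ?D * ?P) $$ (i, j) =
        (\<Sum>k<?n. cnj (of_bool (xs ! k \<subseteq> xs ! i)) * (-1) ^ simplex_dim (xs ! k) * of_bool (xs ! k \<subseteq> xs ! j))"
      unfolding PD using ij by (simp add: inclusion_matrix_def scalar_prod_def lessThan_atLeast0)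
    also have "\<dots> = (\<Sum>k<?n. of_bool (xs ! k \<subseteq> ?w) * (-1) ^ simplex_dim (xs ! k))"
      by (intro sum.cong refl) (simp add: of_bool_def)
    finally show ?thesis .
  qed
  also have "\<dots> = (\<Sum>z\<in>set xs. of_bool (z \<subseteq> ?w) * (-1) ^ simplex_dim z)"
    by (rule sum.reindex_bij_betw[OF bij_betw_nth[OF assms(2) refl refl], of "\<lambda>z. of_bool (z \<subseteq> ?w) * (-1) ^ simplex_dim z"])
  also have "\<dots> = (\<Sum>z | z \<subseteq> ?w \<and> z \<noteq> {}. (-1) ^ (card z - 1))"
  proof (intro sum.mono_neutral_cong_right ballI)
    show "{z. z \<subseteq> ?w \<and> z \<noteq> {}} \<subseteq> set xs"
      using face[of "xs ! i"] ij by auto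
  qed (use ne in \<open>auto simp: simplex_dim_def\<close>)
  also have "\<dots> = of_bool (?w \<noteq> {})"
    by (rule sum_alternating_nonempty_subsets) (use ij fin[of "xs ! i"] in simp)
  finally show "(mat_adjoint ?P * ?D * ?P) $$ (i, j) = connection_laplacian xs $$ (i, j)"
    using ij by (simp add: connection_laplacian_def)
qed (auto simp: connection_laplacian_def inclusion_matrix_def)

section \<open>The Euler characteristic\<close>

theorem corollary1:
  fixes G :: "'a set set" and xs :: "'a set list"
  assumes "finite_abstract_simplicial_complex G"
    and "distinct xs" and "set xs = G"
  shows "of_int (euler_characteristic G) =
    spectral_zeta (connection_laplacian xs) 0
      - 2 * \<i> * deriv (spectral_zeta (connection_laplacian xs)) 0 / of_real pi"
proof -
  let ?L = "connection_laplacian xs" and ?P = "inclusion_matrix xs" and ?n = "length xs"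
  define d :: "nat \<Rightarrow> real" where "d i = (-1) ^ simplex_dim (xs ! i)" for i
  have L: "?L \<in> carrier_mat ?n ?n" and P: "?P \<in> carrier_mat ?n ?n"
    by (simp_all add: connection_laplacian_def inclusion_matrix_def)
  have L_adj: "mat_adjoint ?L = ?L"
    by (intro eq_matI) (auto simp: connection_laplacian_def Int_commute)
  have L_P: "?L = mat_adjoint ?P * mat_diag ?n (\<lambda>i. of_real (d i)) * ?P"
    using connection_laplacian_factorization[of xs] assms by (simp add: d_def)
  have det_P: "det ?P = 1"
    using assms by (intro det_inclusion_matrix) (auto simp: finite_abstract_simplicial_complex_def)
  have "mat_adjoint ?P = transpose_mat ?P"
    by (intro eq_matI) (auto simp: inclusion_matrix_def)
  then have "det (mat_adjoint ?P) = 1"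
    using det_transpose[OF P] det_P by simp
  then have "det ?L = (\<Prod>i<?n. of_real (d i))"
    using P unfolding L_P
    by (simp add: det_mult[of _ ?n] det_P det_mat_diag mult_carrier_mat[of _ ?n ?n _ ?n])
  then have "norm (det ?L) = 1"
    by (simp add: d_def norm_power flip: prod_norm)
  then have "spectral_zeta ?L 0 - 2 * \<i> * deriv (spectral_zeta ?L) 0 / of_real pi =
      of_real (\<Sum>i<?n. sgn (d i))"
    using L L_adj P det_P L_P by (intro hermitian_zeta_signature) auto
  also have "(\<Sum>i<?n. sgn (d i)) = (\<Sum>i<?n. (-1) ^ simplex_dim (xs ! i))"
    by (intro sum.cong) (auto simp: d_def minus_one_power_iff)
  also have "\<dots> = (\<Sum>x\<in>G. (-1) ^ simplex_dim x)"
    by (rule sum.reindex_bij_betw[OF bij_betw_nth[OF assms(2) refl assms(3)[symmetric]]])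
  finally show ?thesis
    by (simp add: euler_characteristic_def)
qed

end
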